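(* Let $\varphi:(0,1]\to(0,\infty)$ be differentiable with $\int_0^1\frac{ds}{\varphi(s)}<\infty$ and \[ \frac{\varphi'(s)}{\varphi(s)}\le\frac{2}{s}\quad\text{for all } s\in(0,1). \] Define, for $A\in[0,1]$ and $N\in[0,1]$, \[ T(A,N)=N\int_0^{N/(A+1)}\frac{ds}{\varphi(s)}. \] Then $T$ is a convex function of $(A,N)$ on $[0,1]\times[0,1]$. *)

theory Defs
  imports "HOL-Analysis.Analysis"
begin

end

(*
  With g x = x * \<integral>\<^sub>0\<^sup>x 1/\<phi>, the function is T (A, N) = (A + 1) * g (N / (A + 1)), the
  perspective of g evaluated at (A + 1, N). Since g'' = (2\<phi> - x\<phi>') / \<phi>\<^sup>2, the hypothesis
  \<phi>'/\<phi> \<le> 2/x says exactly that g is convex, and perspectives of convex functions are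
  jointly convex.
*)
theory Submission
  imports Defs
begin

lemma convex_on_cong:
  assumes "\<And>x. x \<in> S \<Longrightarrow> f x = g x"
  shows "convex_on S f \<longleftrightarrow> convex_on S g"
  using assms by (auto simp: convex_on_def convex_def)

lemma convex_on_realI_Icc:
  fixes f f' :: "real \<Rightarrow> real"
  assumes cont: "continuous_on {a..b} f"
    and der: "\<And>x. x \<in> {a<..<b} \<Longrightarrow> (f has_real_derivative f' x) (at x)"
    and mono: "\<And>x y. x \<in> {a<..<b} \<Longrightarrow> y \<in> {a<..<b} \<Longrightarrow> x \<le> y \<Longrightarrow> f' x \<le> f' y"
  shows "convex_on {a..b} f"
proof (rule convex_on_linorderI)
  show "convex {a..b}" by (rule convex_real_interval)
next
  fix t x y :: real
  assume t: "t > 0" "t < 1"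
  assume xy: "x \<in> {a..b}" "y \<in> {a..b}" "x < y"
  define z where "z = (1 - t) * x + t * y"
  from xy t have xz: "z > x"
    by (simp add: z_def algebra_simps)
  have "y - z = (1 - t) * (y - x)"
    by (simp add: z_def algebra_simps)
  also from xy t have "\<dots> > 0"
    by (intro mult_pos_pos) simp_all
  finally have yz: "z < y"
    by simp
  \<comment> \<open>the mean value theorem on both sides of z; monotonicity of f' orders the two slopes\<close>
  have c1: "continuous_on {x..z} f"
    using cont xy yz by (auto intro: continuous_on_subset)
  have c2: "continuous_on {z..y} f"
    using cont xy xz by (auto intro: continuous_on_subset)
  obtain l \<xi> where \<xi>: "x < \<xi>" "\<xi> < z" "DERIV f \<xi> :> l" "f z - f x = (z - x) * l"
    using MVT[OF xz c1] xy yz der by (force simp: real_differentiable_def)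
  obtain m \<eta> where \<eta>: "z < \<eta>" "\<eta> < y" "DERIV f \<eta> :> m" "f y - f z = (y - z) * m"
    using MVT[OF yz c2] xy xz der by (force simp: real_differentiable_def)
  have \<xi>A: "\<xi> \<in> {a<..<b}" using \<xi> xy yz by auto
  have \<eta>A: "\<eta> \<in> {a<..<b}" using \<eta> xy xz by auto
  have "l = f' \<xi>" using DERIV_unique[OF \<xi>(3) der[OF \<xi>A]] .
  moreover have "m = f' \<eta>" using DERIV_unique[OF \<eta>(3) der[OF \<eta>A]] .
  ultimately have lm: "l \<le> m" using mono[OF \<xi>A \<eta>A] \<xi> \<eta> by auto
  have "(f z - f x) * (y - z) = (z - x) * (y - z) * l" using \<xi>(4) by simp
  also have "\<dots> \<le> (z - x) * (y - z) * m"
    using lm xz yz by (intro mult_left_mono) auto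
  also have "\<dots> = (f y - f z) * (z - x)" using \<eta>(4) by simp
  finally have "(f y - f z) * (z - x) \<ge> (f z - f x) * (y - z)" .
  also have "z - x = t * (y - x)"
    by (simp add: z_def algebra_simps)
  also have "y - z = (1 - t) * (y - x)"
    by (simp add: z_def algebra_simps)
  finally have "(f y - f z) * t \<ge> (f z - f x) * (1 - t)"
    using xy by simp
  then show "(1 - t) * f x + t * f y \<ge> f ((1 - t) *\<^sub>R x + t *\<^sub>R y)"
    by (simp add: z_def algebra_simps)
qed

lemma convex_on_mult_integral:
  fixes f f' :: "real \<Rightarrow> real"
  assumes int: "f integrable_on {a..b}"
    and der: "\<And>x. x \<in> {a<..<b} \<Longrightarrow> (f has_real_derivative f' x) (at x)"
    and curv: "\<And>x. x \<in> {a<..<b} \<Longrightarrow> 0 \<le> 2 * f x + x * f' x"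
  shows "convex_on {a..b} (\<lambda>x. x * integral {a..x} f)"
proof -
  define F where "F = (\<lambda>x. integral {a..x} f)"
  have dF: "(F has_real_derivative f x) (at x)" if x: "x \<in> {a<..<b}" for x
  proof -
    have "continuous (at x within {a..b}) f"
      using DERIV_isCont[OF der[OF x]] by (rule continuous_at_imp_continuous_within)
    then have "(F has_vector_derivative f x) (at x within {a..b})"
      using integral_has_vector_derivative_continuous_at[OF int, of x "{}"] x
      by (simp add: F_def)
    moreover have "at x within {a..b} = at x"
      using x by (intro at_within_interior) auto
    ultimately show ?thesis
      by (simp add: has_real_derivative_iff_has_vector_derivative)
  qed
  have dg: "((\<lambda>x. x * F x) has_real_derivative F x + x * f x) (at x)"
    if "x \<in> {a<..<b}" for x
    using DERIV_mult[OF DERIV_ident dF[OF that]] by (simp add: mult.commute)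
  have dg': "((\<lambda>x. F x + x * f x) has_real_derivative 2 * f x + x * f' x) (at x)"
    if "x \<in> {a<..<b}" for x
    using DERIV_add[OF dF[OF that] DERIV_mult[OF DERIV_ident der[OF that]]]
    by (simp add: algebra_simps)
  have "continuous_on {a..b} (\<lambda>x. x * F x)"
    unfolding F_def by (intro continuous_intros indefinite_integral_continuous_1 int)
  then have "convex_on {a..b} (\<lambda>x. x * F x)"
  proof (rule convex_on_realI_Icc[OF _ dg])
    fix x y assume "x \<in> {a<..<b}" "y \<in> {a<..<b}" "x \<le> y"
    show "F x + x * f x \<le> F y + y * f y"
    proof (rule DERIV_nonneg_imp_nondecreasing[OF \<open>x \<le> y\<close>])
      fix z assume "x \<le> z" "z \<le> y"
      with \<open>x \<in> {a<..<b}\<close> \<open>y \<in> {a<..<b}\<close> have "z \<in> {a<..<b}"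
        by auto
      with dg' curv show "\<exists>l. ((\<lambda>x. F x + x * f x) has_real_derivative l) (at z) \<and> 0 \<le> l"
        by blast
    qed
  qed
  then show ?thesis
    by (simp add: F_def)
qed

lemma convex_on_perspective:
  fixes g :: "'a::real_vector \<Rightarrow> real"
  assumes "convex_on C g"
  shows "convex_on {(a, x). 0 < a \<and> x /\<^sub>R a \<in> C} (\<lambda>(a, x). a * g (x /\<^sub>R a))"
    (is "convex_on ?D ?P")
proof -
  have "u *\<^sub>R p + v *\<^sub>R q \<in> ?D \<and> ?P (u *\<^sub>R p + v *\<^sub>R q) \<le> u * ?P p + v * ?P q"
    if pq: "p \<in> ?D" "q \<in> ?D" and uv: "0 \<le> u" "0 \<le> v" "u + v = 1" for p q u v
  proof -
    obtain a1 x1 a2 x2 where pq': "p = (a1, x1)" "q = (a2, x2)" "0 < a1" "0 < a2"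
      and C1: "x1 /\<^sub>R a1 \<in> C" and C2: "x2 /\<^sub>R a2 \<in> C"
      using pq by auto
    define a where "a = u * a1 + v * a2"
    have "0 < a"
      using pq' uv by (cases "u = 0") (auto simp: a_def add_pos_nonneg)
    have weights: "0 \<le> u * a1 / a" "0 \<le> v * a2 / a" "u * a1 / a + v * a2 / a = 1"
      using \<open>0 < a\<close> pq'(3,4) uv by (auto simp: a_def add_divide_distrib[symmetric])
    have comb: "(u *\<^sub>R x1 + v *\<^sub>R x2) /\<^sub>R a
        = (u * a1 / a) *\<^sub>R (x1 /\<^sub>R a1) + (v * a2 / a) *\<^sub>R (x2 /\<^sub>R a2)"
      using pq'(3,4) by (simp add: scaleR_add_right mult.assoc divide_inverse_commute)
    have "g ((u *\<^sub>R x1 + v *\<^sub>R x2) /\<^sub>R a)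
        \<le> u * a1 / a * g (x1 /\<^sub>R a1) + v * a2 / a * g (x2 /\<^sub>R a2)"
      using assms C1 C2 weights unfolding comb convex_on_def by blast
    then have "a * g ((u *\<^sub>R x1 + v *\<^sub>R x2) /\<^sub>R a)
        \<le> u * (a1 * g (x1 /\<^sub>R a1)) + v * (a2 * g (x2 /\<^sub>R a2))"
      using \<open>0 < a\<close> by (simp add: field_simps)
    moreover have "(u *\<^sub>R x1 + v *\<^sub>R x2) /\<^sub>R a \<in> C"
      unfolding comb using convex_on_imp_convex[OF assms] C1 C2 weights by (rule convexD)
    ultimately show ?thesis
      using \<open>0 < a\<close> by (simp add: pq' a_def)
  qed
  then show ?thesis
    by (auto simp: convex_on_def convex_def)
qed

lemma convex_on_shift:
  fixes f :: "'a::real_vector \<Rightarrow> real"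
  assumes f: "convex_on S f" and T: "convex T" and shift: "\<And>x. x \<in> T \<Longrightarrow> x + c \<in> S"
  shows "convex_on T (\<lambda>x. f (x + c))"
proof -
  have "f (u *\<^sub>R x + v *\<^sub>R y + c) \<le> u * f (x + c) + v * f (y + c)"
    if "x \<in> T" "y \<in> T" "0 \<le> u" "0 \<le> v" "u + v = 1" for x y u v
  proof -
    have "u *\<^sub>R (x + c) + v *\<^sub>R (y + c) = u *\<^sub>R x + v *\<^sub>R y + (u + v) *\<^sub>R c"
      by (simp add: scaleR_add_right scaleR_add_left)
    then have "u *\<^sub>R x + v *\<^sub>R y + c = u *\<^sub>R (x + c) + v *\<^sub>R (y + c)"
      using \<open>u + v = 1\<close> by simp
    moreover have "f (u *\<^sub>R (x + c) + v *\<^sub>R (y + c)) \<le> u * f (x + c) + v * f (y + c)"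
      using f shift[OF \<open>x \<in> T\<close>] shift[OF \<open>y \<in> T\<close>] that(3-5) unfolding convex_on_def by blast
    ultimately show ?thesis
      by simp
  qed
  then show ?thesis
    using T by (simp add: convex_on_def)
qed

theorem mainTheorem6:
  fixes \<phi> \<phi>' :: "real \<Rightarrow> real"
  assumes pos: "\<And>s. s \<in> {0<..1} \<Longrightarrow> \<phi> s > 0"
    and deriv: "\<And>s. s \<in> {0<..1} \<Longrightarrow> (\<phi> has_real_derivative \<phi>' s) (at s within {0<..1})"
    and integrable: "(\<lambda>s. 1 / \<phi> s) integrable_on {0<..1}"
    and logderiv: "\<And>s. s \<in> {0<..<1} \<Longrightarrow> \<phi>' s / \<phi> s \<le> 2 / s"
  shows "convex_on ({0..1} \<times> {0..1})
           (\<lambda>(A, N). N * integral {0..N / (A + 1)} (\<lambda>s. 1 / \<phi> s))"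
proof -
  let ?f = "\<lambda>s. 1 / \<phi> s"
  have "{0..1::real} = insert 0 {0<..1}"
    by auto
  then have int01: "?f integrable_on {0..1}"
    using integrable integrable_on_insert_iff by metis
  have d\<phi>: "(\<phi> has_real_derivative \<phi>' s) (at s)" if s: "s \<in> {0<..<1}" for s
  proof -
    have "(\<phi> has_real_derivative \<phi>' s) (at s within {0<..<1})"
      using deriv[of s] s by (auto intro: has_field_derivative_subset)
    then show ?thesis
      using s at_within_open[of s "{0<..<1::real}"] by simp
  qed
  have "convex_on {0..1} (\<lambda>x. x * integral {0..x} ?f)"
  proof (rule convex_on_mult_integral[OF int01])
    fix x :: real assume x: "x \<in> {0<..<1}"
    have \<phi>x: "0 < \<phi> x"
      using pos x by auto
    show "(?f has_real_derivative - \<phi>' x / (\<phi> x)\<^sup>2) (at x)"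
      using d\<phi>[OF x] \<phi>x by (auto intro!: derivative_eq_intros simp: power2_eq_square)
    have "x * \<phi>' x \<le> 2 * \<phi> x"
      using logderiv[OF x] \<phi>x x by (simp add: divide_simps mult.commute)
    then show "0 \<le> 2 * ?f x + x * (- \<phi>' x / (\<phi> x)\<^sup>2)"
      using \<phi>x by (simp add: field_simps power2_eq_square)
  qed
  then have "convex_on {(a, x). 0 < a \<and> x /\<^sub>R a \<in> {0..1}}
      (\<lambda>(a, x). a * (x /\<^sub>R a * integral {0..x /\<^sub>R a} ?f))"
    by (rule convex_on_perspective)
  then have "convex_on ({0..1} \<times> {0..1})
      (\<lambda>p. case p + (1, 0) of (a, x) \<Rightarrow> a * (x /\<^sub>R a * integral {0..x /\<^sub>R a} ?f))"
    by (rule convex_on_shift) (auto intro: convex_Times simp: field_simps)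
  then show ?thesis
    by (rule convex_on_cong[THEN iffD1, rotated]) (auto simp: divide_inverse_commute)
qed

end
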